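(* Let $-\infty<a<b<+\infty$, let $f:[a;b]\rightarrow\mathbb{R}$ be a càdlàg function and let $c>0$. Then $$\inf\left\{TV\left(f+h,[a;b]\right):h:[a;b]\to\mathbb{R},\ \|h\|_{osc}\leq c\right\}=TV^{c}\left(f,[a;b]\right).$$ The infimum is attained at $h^c=f^c-f$ for some càdlàg function $f^c:[a;b]\to\mathbb{R}$ with $\|f^c-f\|_\infty\le c/2$ and $TV(f^c,[a;b])=TV^c(f,[a;b])$. It is also attained at some $h^{0,c}:[a;b]\to\mathbb{R}$ with $\|h^{0,c}\|_{osc}\le c$ and $h^{0,c}(a)=0$, such that the function $f^{0,c}=f+h^{0,c}-f(a)$ is càdlàg, every point of discontinuity of $f^{0,c}$ is a point of discontinuity of $f$, and for every $s\in(a;b]$ $$f^{0,c}(s)=UTV^{c}\left(f,[a;s]\right)-DTV^{c}\left(f,[a;s]\right),$$ $$TV\left(f^{0,c},[a;s]\right)=TV^{c}\left(f,[a;s]\right)=UTV^{c}\left(f,[a;s]\right)+DTV^{c}\left(f,[a;s]\right).$$ These equalities give the Hahn-Jordan decomposition $\mu=\mu_+-\mu_-$ of the finite signed measure $\mu$ on $(a;b]$ determined by $\mu(a_1,b_1]=f^{0,c}(b_1)-f^{0,c}(a_1)$ for $(a_1,b_1]\subset(a;b]$; namely, for $(a_1,b_1]\subset(a;b]$, $$\mu_+(a_1,b_1]=UTV^{c}(f,[a;b_1])-UTV^{c}(f,[a;a_1]),\qquad \mu_-(a_1,b_1]=DTV^{c}(f,[a;b_1])-DTV^{c}(f,[a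;a_1]).$$
   Context: A càdlàg function is a right-continuous function with left limits. For $h:[a;b]\rightarrow\mathbb{R}$, $\|h\|_\infty=\sup_{t\in[a;b]}|h(t)|$ and $\|h\|_{osc}=\sup_{s,u\in[a;b]}|h(s)-h(u)|$. For $s\in(a;b]$ define $$TV(g,[a;s])=\sup_{n}\sup_{a\leq t_0<\ldots<t_n\leq s}\sum_{i=1}^{n}|g(t_i)-g(t_{i-1})|,$$ $$TV^{c}(f,[a;s])=\sup_{n}\sup_{a\leq t_0<\ldots<t_n\leq s}\sum_{i=1}^{n}\max\{|f(t_i)-f(t_{i-1})|-c,0\},$$ $$UTV^{c}(f,[a;s])=\sup_{n}\sup_{a\leq t_0<\ldots<t_n\leq s}\sum_{i=1}^{n}\max\{f(t_i)-f(t_{i-1})-c,0\},$$ $$DTV^{c}(f,[a;s])=\sup_{n}\sup_{a\leq t_0<\ldots<t_n\leq s}\sum_{i=1}^{n}\max\{f(t_{i-1})-f(t_i)-c,0\}$$ (total variation, truncated variation, upward and downward truncated variation). For $s=a$ all these quantities are $0$. *)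

theory Defs
  imports "HOL-Analysis.Analysis"
begin

definition cadlag_on :: "real \<Rightarrow> real \<Rightarrow> (real \<Rightarrow> real) \<Rightarrow> bool" where
  "cadlag_on a b f \<longleftrightarrow>
     (\<forall>t\<in>{a..<b}. (f \<longlongrightarrow> f t) (at_right t)) \<and>
     (\<forall>t\<in>{a<..b}. \<exists>l. (f \<longlongrightarrow> l) (at_left t))"

definition sup_norm :: "real \<Rightarrow> real \<Rightarrow> (real \<Rightarrow> real) \<Rightarrow> ereal" where
  "sup_norm a b h = (SUP t\<in>{a..b}. ereal \<bar>h t\<bar>)"

definition osc_norm :: "real \<Rightarrow> real \<Rightarrow> (real \<Rightarrow> real) \<Rightarrow> ereal" where
  "osc_norm a b h = (SUP s\<in>{a..b}. SUP u\<in>{a..b}. ereal \<bar>h s - h u\<bar>)"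

(* Only the values t 0, ..., t n matter.  For n = 0 the variation sums below are empty, so
   each supremum is at least 0, and it is exactly 0 on the degenerate interval [a; a]. *)
definition partitions :: "real \<Rightarrow> real \<Rightarrow> nat \<Rightarrow> (nat \<Rightarrow> real) set" where
  "partitions a s n = {t. a \<le> t 0 \<and> strict_mono_on {..n} t \<and> t n \<le> s}"

definition TV :: "(real \<Rightarrow> real) \<Rightarrow> real \<Rightarrow> real \<Rightarrow> ereal" where
  "TV g a s = (SUP n. SUP t\<in>partitions a s n.
     ereal (\<Sum>i=1..n. \<bar>g (t i) - g (t (i - 1))\<bar>))"

definition TVc :: "real \<Rightarrow> (real \<Rightarrow> real) \<Rightarrow> real \<Rightarrow> real \<Rightarrow> ereal" where
  "TVc c f a s = (SUP n. SUP t\<in>partitions a s n.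
     ereal (\<Sum>i=1..n. max (\<bar>f (t i) - f (t (i - 1))\<bar> - c) 0))"

definition UTVc :: "real \<Rightarrow> (real \<Rightarrow> real) \<Rightarrow> real \<Rightarrow> real \<Rightarrow> ereal" where
  "UTVc c f a s = (SUP n. SUP t\<in>partitions a s n.
     ereal (\<Sum>i=1..n. max (f (t i) - f (t (i - 1)) - c) 0))"

definition DTVc :: "real \<Rightarrow> (real \<Rightarrow> real) \<Rightarrow> real \<Rightarrow> real \<Rightarrow> ereal" where
  "DTVc c f a s = (SUP n. SUP t\<in>partitions a s n.
     ereal (\<Sum>i=1..n. max (f (t (i - 1)) - f (t i) - c) 0))"

(* Real-valued, hence finite; only the sigma-algebra of M is used, not its measure. *)
definition finite_signed_measure :: "'a measure \<Rightarrow> ('a set \<Rightarrow> real) \<Rightarrow> bool" where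
  "finite_signed_measure M \<mu> \<longleftrightarrow>
     \<mu> {} = 0 \<and>
     (\<forall>A :: nat \<Rightarrow> 'a set. range A \<subseteq> sets M \<longrightarrow> disjoint_family A \<longrightarrow>
        (\<lambda>n. \<mu> (A n)) sums \<mu> (\<Union>n. A n))"

definition hahn_set :: "'a measure \<Rightarrow> ('a set \<Rightarrow> real) \<Rightarrow> 'a set \<Rightarrow> bool" where
  "hahn_set M \<mu> P \<longleftrightarrow>
     P \<in> sets M \<and>
     (\<forall>A\<in>sets M. A \<subseteq> P \<longrightarrow> 0 \<le> \<mu> A) \<and>
     (\<forall>A\<in>sets M. A \<subseteq> space M - P \<longrightarrow> \<mu> A \<le> 0)"

definition hahn_jordan ::
  "'a measure \<Rightarrow> ('a set \<Rightarrow> real) \<Rightarrow> 'a measure \<Rightarrow> 'a measure \<Rightarrow> bool" where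
  "hahn_jordan M \<mu> Mp Mn \<longleftrightarrow>
     sets Mp = sets M \<and> sets Mn = sets M \<and> finite_measure Mp \<and> finite_measure Mn \<and>
     (\<forall>A\<in>sets M. \<mu> A = measure Mp A - measure Mn A) \<and>
     (\<exists>P. hahn_set M \<mu> P \<and>
        (\<forall>A\<in>sets M. measure Mp A = \<mu> (A \<inter> P) \<and> measure Mn A = - \<mu> (A - P)))"

end

(* Let U and D be the upward and downward truncated variations of f on [a;s].  For a finite
   sequence x the maximum U k of the sums satisfies U (k+1) = max (U k) (x (k+1) + A k - c) with
   A k = max_{i <= k} (U i - x i), so U and A are the upper and lower pushing terms that keep
   x + A - U in [0, c]; D is obtained from -x with a term A'.  The two reflected paths
   x + A - U <= c + x - A' + D keep their order.  Hence A - D and A' - U are nondecreasing,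
   (A - D) + (A' - U) <= c, and all values of U - D - x lie in an interval of length c; moreover
   U + D is at most the truncated variation of x.  Both facts pass to the interval by taking finer
   and finer grids.  As h with oscillation at most c changes every increment by at most c, the
   function g = U - D satisfies TV^c f <= TV g <= U + D <= TV^c f, which gives all equalities.
   Finally, TV g = U + D leaves no room for cancellation between dU and dD on a Hahn set. *)

theory Submission
  imports Defs
begin

section \<open>Suprema over partitions\<close>

text \<open>The kernel \<open>\<phi>\<close> unifies the suprema: \<open>abs\<close>,
  \<open>max (\<bar>x\<bar> - c) 0\<close> and \<open>max (x - c) 0\<close> give \<open>TV\<close>,
  \<open>TVc\<close> and \<open>UTVc\<close>, while \<open>DTVc\<close> is \<open>UTVc\<close> of
  the negated function.\<close>

definition incr_var :: "(real \<Rightarrow> real) \<Rightarrow> (real \<Rightarrow> real) \<Rightarrow> real \<Rightarrow> real \<Rightarrow> ereal" where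
  "incr_var \<phi> g a s = (SUP n. SUP t\<in>partitions a s n.
     ereal (\<Sum>i=1..n. \<phi> (g (t i) - g (t (i - 1)))))"

lemma TV_eq_incr_var: "TV g = incr_var abs g"
  by (simp add: fun_eq_iff TV_def incr_var_def)

lemma TVc_eq_incr_var: "TVc c g = incr_var (\<lambda>x. max (\<bar>x\<bar> - c) 0) g"
  by (simp add: fun_eq_iff TVc_def incr_var_def)

lemma UTVc_eq_incr_var: "UTVc c g = incr_var (\<lambda>x. max (x - c) 0) g"
  by (simp add: fun_eq_iff UTVc_def incr_var_def)

lemma DTVc_eq_UTVc: "DTVc c g = UTVc c (\<lambda>t. - g t)"
  by (simp add: fun_eq_iff UTVc_def DTVc_def)

lemma TV_translate: "TV (\<lambda>t. g t + r) = TV g"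
  by (simp add: fun_eq_iff TV_def)

lemma incr_var_ge:
  "t \<in> partitions a s n \<Longrightarrow> ereal (\<Sum>i=1..n. \<phi> (g (t i) - g (t (i - 1)))) \<le> incr_var \<phi> g a s"
  unfolding incr_var_def by (intro SUP_upper2[of n] SUP_upper2[of t]) auto

lemma incr_var_leI:
  assumes "\<And>n t. t \<in> partitions a s n \<Longrightarrow> ereal (\<Sum>i=1..n. \<phi> (g (t i) - g (t (i - 1)))) \<le> B"
  shows "incr_var \<phi> g a s \<le> B"
  unfolding incr_var_def using assms by (intro SUP_least)

lemma partitions_snoc:
  assumes "t \<in> partitions a s n" "t n < v"
  shows "t(Suc n := v) \<in> partitions a v (Suc n)"
proof -
  have "strict_mono_on {..Suc n} (t(Suc n := v))"
  proof (rule strict_mono_onI)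
    fix i j assume ij: "i \<in> {..Suc n}" "j \<in> {..Suc n}" "i < j"
    have m: "strict_mono_on {..n} t" using assms by (auto simp: partitions_def)
    show "(t(Suc n := v)) i < (t(Suc n := v)) j"
    proof (cases "j = Suc n")
      case True
      have "t i \<le> t n"
        using ij True by (intro strict_mono_on_leD[OF m]) auto
      then show ?thesis using True ij assms by auto
    next
      case False
      then show ?thesis using ij by (auto intro!: strict_mono_onD[OF m])
    qed
  qed
  then show ?thesis using assms by (auto simp: partitions_def)
qed

lemma incr_sum_snoc:
  "(\<Sum>i=1..Suc n. \<phi> (g ((t(Suc n := v)) i) - g ((t(Suc n := v)) (i - 1))))
     = (\<Sum>i=1..n. \<phi> (g (t i) - g (t (i - 1)))) + (\<phi> (g v - g (t n)) :: real)"
proof -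
  have "(\<Sum>i=1..n. \<phi> (g ((t(Suc n := v)) i) - g ((t(Suc n := v)) (i - 1))))
     = (\<Sum>i=1..n. \<phi> (g (t i) - g (t (i - 1))))"
    by (intro sum.cong) auto
  then show ?thesis by simp
qed

text \<open>A partition of \<open>[a; s]\<close> is prolonged by \<open>v\<close>, after
  \<open>s\<close> has been appended if the last point lies before \<open>s\<close>; appending
  \<open>s\<close> costs nothing because the kernel is nonnegative.\<close>

lemma incr_var_superadd:
  assumes "\<And>x. 0 \<le> \<phi> x" "\<phi> 0 = 0" "a \<le> s" "s \<le> v"
  shows "incr_var \<phi> g a s + ereal (\<phi> (g v - g s)) \<le> incr_var \<phi> g a v"
proof (cases "s = v")
  case True
  then show ?thesis using assms by simp
next
  case False
  then have sv: "s < v" using assms by simp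
  have "incr_var \<phi> g a s \<le> incr_var \<phi> g a v - ereal (\<phi> (g v - g s))"
  proof (rule incr_var_leI)
    fix n t assume t: "t \<in> partitions a s n"
    then have "t n \<le> s" by (auto simp: partitions_def)
    then consider "t n = s" | "t n < s" by linarith
    then have "ereal (\<Sum>i=1..n. \<phi> (g (t i) - g (t (i - 1)))) + ereal (\<phi> (g v - g s)) \<le> incr_var \<phi> g a v"
    proof cases
      case 1
      then show ?thesis
        using incr_var_ge[OF partitions_snoc[OF t, of v], of \<phi> g] sv
        by (simp only: incr_sum_snoc) simp
    next
      case 2
      have t2: "t(Suc n := s) \<in> partitions a s (Suc n)" using partitions_snoc[OF t 2] .
      have "ereal (\<Sum>i=1..n. \<phi> (g (t i) - g (t (i - 1)))) + ereal (\<phi> (g v - g s)) \<le>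
            ereal ((\<Sum>i=1..n. \<phi> (g (t i) - g (t (i - 1)))) + \<phi> (g s - g (t n)) + \<phi> (g v - g s))"
        using assms(1)[of "g s - g (t n)"] by simp
      also have "\<dots> \<le> incr_var \<phi> g a v"
        using incr_var_ge[OF partitions_snoc[OF t2, of v], of \<phi> g] sv
        by (simp only: incr_sum_snoc) simp
      finally show ?thesis .
    qed
    then show "ereal (\<Sum>i=1..n. \<phi> (g (t i) - g (t (i - 1)))) \<le> incr_var \<phi> g a v - ereal (\<phi> (g v - g s))"
      by (subst ereal_le_minus) auto
  qed
  then show ?thesis by (subst (asm) ereal_le_minus) auto
qed

text \<open>The increments of \<open>W\<close> along a partition telescope. With
  \<open>incr_var_superadd\<close> this makes the variation the least superadditive majorant that is
  nonnegative at \<open>a\<close>, and upper bounds are obtained by choosing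
  \<open>W\<close>.\<close>

lemma incr_var_le_superadd:
  assumes W: "\<And>u v. a \<le> u \<Longrightarrow> u \<le> v \<Longrightarrow> v \<le> s \<Longrightarrow> W u + \<phi> (g v - g u) \<le> W v"
    and \<phi>: "\<And>x. 0 \<le> \<phi> x" and W0: "0 \<le> W a"
  shows "incr_var \<phi> g a s \<le> ereal (W s)"
proof (rule incr_var_leI)
  fix n t assume t: "t \<in> partitions a s n"
  then have m: "strict_mono_on {..n} t" and t0: "a \<le> t 0" "t n \<le> s" by (auto simp: partitions_def)
  have mon: "W u \<le> W v" if "a \<le> u" "u \<le> v" "v \<le> s" for u v
    using W[OF that] \<phi>[of "g v - g u"] by simp
  have rng: "t k \<le> s" "a \<le> t k" if "k \<le> n" for k
    using strict_mono_on_leD[OF m, of k n] strict_mono_on_leD[OF m, of 0 k] that t0 by auto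
  have "(\<Sum>i=1..k. \<phi> (g (t i) - g (t (i - 1)))) \<le> W (t k)" if "k \<le> n" for k
    using that
  proof (induction k)
    case 0
    then show ?case using mon[of a "t 0"] W0 t0 rng[of 0] by simp
  next
    case (Suc k)
    have "W (t k) + \<phi> (g (t (Suc k)) - g (t k)) \<le> W (t (Suc k))"
      using rng Suc.prems by (intro W strict_mono_on_leD[OF m]) auto
    then show ?case using Suc by simp
  qed
  from this[of n] show "ereal (\<Sum>i=1..n. \<phi> (g (t i) - g (t (i - 1)))) \<le> ereal (W s)"
    using mon[of "t n" s] rng[of n] t0 by simp
qed

lemma incr_var_nonneg: "a \<le> s \<Longrightarrow> 0 \<le> incr_var \<phi> g a s"
proof -
  assume "a \<le> s"
  then have "(\<lambda>_. a) \<in> partitions a s 0" by (auto simp: partitions_def intro!: strict_mono_onI)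
  from incr_var_ge[OF this, of \<phi> g] show ?thesis by (simp add: zero_ereal_def)
qed

lemma incr_var_at_left_end:
  assumes "\<And>x. 0 \<le> \<phi> x" "\<phi> 0 = 0"
  shows "incr_var \<phi> g a a = 0"
proof (rule antisym)
  show "incr_var \<phi> g a a \<le> 0"
    unfolding zero_ereal_def
  proof (rule incr_var_le_superadd)
    show "0 + \<phi> (g v - g u) \<le> 0" if "a \<le> u" "u \<le> v" "v \<le> a" for u v
    proof -
      have "u = v" using that by linarith
      then show ?thesis using assms by simp
    qed
  qed (use assms in auto)
qed (simp add: incr_var_nonneg)

lemma incr_var_mono:
  assumes "\<And>n t. t \<in> partitions a s n \<Longrightarrow> (\<And>i. i \<le> n \<Longrightarrow> t i \<in> {a..s}) \<Longrightarrow>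
      (\<Sum>i=1..n. \<phi> (g (t i) - g (t (i - 1)))) \<le> (\<Sum>i=1..n. \<psi> (h (t i) - h (t (i - 1))))"
  shows "incr_var \<phi> g a s \<le> incr_var \<psi> h a s"
proof (rule incr_var_leI)
  fix n t assume t: "t \<in> partitions a s n"
  then have m: "strict_mono_on {..n} t" and t0: "a \<le> t 0" "t n \<le> s" by (auto simp: partitions_def)
  have rng: "t k \<in> {a..s}" if "k \<le> n" for k
    using strict_mono_on_leD[OF m, of k n] strict_mono_on_leD[OF m, of 0 k] that t0 by auto
  show "ereal (\<Sum>i=1..n. \<phi> (g (t i) - g (t (i - 1)))) \<le> incr_var \<psi> h a s"
    using assms[OF t rng] incr_var_ge[OF t, of \<psi> h] by (meson ereal_less_eq(3) order_trans)
qed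

section \<open>The recursion on a finite grid\<close>

text \<open>For a finite sequence \<open>x\<close>, the first component is the upward truncated variation up to
  index \<open>k\<close>, the second one is the maximum over \<open>i \<le> k\<close> of that variation at \<open>i\<close> minus \<open>x i\<close>.\<close>

fun trunc_rec :: "real \<Rightarrow> (nat \<Rightarrow> real) \<Rightarrow> nat \<Rightarrow> real \<times> real" where
  "trunc_rec c x 0 = (0, - x 0)"
| "trunc_rec c x (Suc k) =
     (let u = max (fst (trunc_rec c x k)) (x (Suc k) + snd (trunc_rec c x k) - c)
      in (u, max (snd (trunc_rec c x k)) (u - x (Suc k))))"

definition "up c x k = fst (trunc_rec c x k)"
definition "low c x k = snd (trunc_rec c x k)"

lemma up_0: "up c x 0 = 0" and low_0: "low c x 0 = - x 0"
  by (simp_all add: up_def low_def)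

lemma up_Suc: "up c x (Suc k) = max (up c x k) (x (Suc k) + low c x k - c)"
  by (simp add: up_def low_def Let_def)

lemma low_Suc: "low c x (Suc k) = max (low c x k) (up c x (Suc k) - x (Suc k))"
  by (simp add: up_def low_def Let_def)

lemma up_mono: "i \<le> k \<Longrightarrow> up c x i \<le> up c x k"
  by (induction k rule: dec_induct) (auto simp: up_Suc)

lemma low_ge: "i \<le> k \<Longrightarrow> up c x i - x i \<le> low c x k"
proof (induction k rule: dec_induct)
  case base
  then show ?case by (cases i) (auto simp: up_0 low_0 low_Suc)
next
  case (step k)
  then show ?case by (auto simp: low_Suc)
qed

text \<open>With \<open>low_ge\<close> this identifies \<open>low\<close> as a maximum; the
  maximising index brings bounds on earlier values of \<open>up\<close> into play when
  \<open>up\<close> rises.\<close>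

lemma low_attained: "\<exists>i\<le>k. low c x k = up c x i - x i"
proof (induction k)
  case 0
  then show ?case by (auto simp: up_0 low_0)
next
  case (Suc k)
  then show ?case
    by (cases "low c x k \<ge> up c x (Suc k) - x (Suc k)") (auto simp: low_Suc max_def intro: le_SucI)
qed

text \<open>For \<open>i < k\<close> only the last step of the recursion matters: \<open>low\<close>
  at \<open>k - 1\<close> already contains the candidate \<open>i\<close>.\<close>

lemma up_superadd:
  assumes "0 \<le> c" "i \<le> k"
  shows "up c x i + max (x k - x i - c) 0 \<le> up c x k"
proof (cases "i = k")
  case True
  then show ?thesis using assms by simp
next
  case False
  then obtain k' where k: "k = Suc k'" "i \<le> k'" using assms by (cases k) auto
  then show ?thesis using low_ge[OF k(2), of c x] up_mono[OF assms(2), of c x] by (auto simp: up_Suc)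
qed

text \<open>A rise of \<open>up\<close> ends at \<open>up c x i + x k - x i - c\<close> for some
  earlier \<open>i\<close>, which strong induction bounds by \<open>W k\<close>. So
  \<open>up\<close> is the least superadditive majorant on the grid.\<close>

lemma up_le_superadd:
  assumes W: "\<And>i k. i \<le> k \<Longrightarrow> k \<le> N \<Longrightarrow> W i + max (x k - x i - c) 0 \<le> W k" and "0 \<le> W 0"
  shows "k \<le> N \<Longrightarrow> up c x k \<le> W k"
proof (induction k rule: less_induct)
  case (less k)
  show ?case
  proof (cases k)
    case 0
    then show ?thesis using assms by (simp add: up_0)
  next
    case (Suc k')
    obtain i where i: "i \<le> k'" "low c x k' = up c x i - x i" using low_attained by blast
    show ?thesis
      using less.IH[of k'] less.IH[of i] W[of i k] W[of k' k] i less.prems Suc by (auto simp: up_Suc)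
  qed
qed

text \<open>Primes refer to \<open>- x\<close>. The paths x + low - up and c + x - low' + up' both
  move by the increments of \<open>x\<close> and are then clipped to [0; c]. They start at 0 and
  \<open>c\<close>, and clipping preserves their order.\<close>

lemma trunc_rec_coupling:
  assumes "0 \<le> c"
  shows "low c x k + low c (\<lambda>i. - x i) k \<le> c + up c x k + up c (\<lambda>i. - x i) k"
proof (induction k)
  case 0
  then show ?case using assms by (simp add: up_0 low_0)
next
  case (Suc k)
  have "up c x k - x k \<le> low c x k" "up c (\<lambda>i. - x i) k + x k \<le> low c (\<lambda>i. - x i) k"
    using low_ge[of k k c x] low_ge[of k k c "\<lambda>i. - x i"] by auto
  then show ?case using Suc assms by (auto simp: up_Suc low_Suc)
qed

text \<open>In each step \<open>low\<close> rises by the amount by which the lower of the two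
  coupled paths would fall below 0, and up' by the corresponding amount for the upper path, which is
  no larger.\<close>

lemma low_minus_up_mono:
  assumes "0 \<le> c" "i \<le> k"
  shows "low c x i - up c (\<lambda>i. - x i) i \<le> low c x k - up c (\<lambda>i. - x i) k"
  using assms(2)
proof (induction k rule: dec_induct)
  case (step k)
  then show ?case using trunc_rec_coupling[OF assms(1), of x k] by (auto simp: up_Suc low_Suc)
qed simp

text \<open>All values of \<open>up - up' - x\<close> up to index \<open>k\<close> lie in one interval, whose length is at
  most \<open>c\<close> by the coupling inequality.\<close>

lemma up_diff_osc:
  assumes "0 \<le> c" "i \<le> k" "j \<le> k"
  shows "(up c x i - up c (\<lambda>i. - x i) i - x i) - (up c x j - up c (\<lambda>i. - x i) j - x j) \<le> c"
  \<comment> \<open>The interval has upper end low - up' and lower end up - low', both taken at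
    index \<open>k\<close>.\<close>
  using low_minus_up_mono[OF assms(1,2), of x] low_minus_up_mono[OF assms(1,3), of "\<lambda>i. - x i"]
    trunc_rec_coupling[OF assms(1), of x k] low_ge[of i i c x] low_ge[of j j c "\<lambda>i. - x i"]
  by simp

text \<open>By the coupling inequality \<open>up\<close> and up' never rise in the same step. If
  \<open>up\<close> rises, the new sum is x (k+1) + low + up' - c, so the induction also has to
  bound low + up' by some \<open>W i - x i\<close>, and symmetrically low' + up.\<close>

lemma up_add_le_superadd:
  assumes W: "\<And>i k. i \<le> k \<Longrightarrow> k \<le> N \<Longrightarrow> W i + max (\<bar>x k - x i\<bar> - c) 0 \<le> W k" and "0 \<le> W 0" "0 \<le> c"
  shows "k \<le> N \<Longrightarrow> up c x k + up c (\<lambda>i. - x i) k \<le> W k"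
proof -
  have "k \<le> N \<Longrightarrow> up c x k + up c (\<lambda>i. - x i) k \<le> W k
     \<and> (\<exists>i\<le>k. low c x k + up c (\<lambda>i. - x i) k \<le> W i - x i)
     \<and> (\<exists>i\<le>k. low c (\<lambda>i. - x i) k + up c x k \<le> W i + x i)"
  proof (induction k)
    case 0
    then show ?case using assms by (simp add: up_0 low_0)
  next
    case (Suc k)
    obtain i j where ij: "i \<le> k" "low c x k + up c (\<lambda>i. - x i) k \<le> W i - x i"
      "j \<le> k" "low c (\<lambda>i. - x i) k + up c x k \<le> W j + x j"
      and IH: "up c x k + up c (\<lambda>i. - x i) k \<le> W k" using Suc by auto
    note inv = trunc_rec_coupling[OF \<open>0 \<le> c\<close>, of x k]
    have 1: "up c x (Suc k) + up c (\<lambda>i. - x i) (Suc k) \<le> W (Suc k)"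
      using W[of i "Suc k"] W[of j "Suc k"] W[of k "Suc k"] ij IH inv Suc.prems \<open>0 \<le> c\<close>
      by (auto simp: up_Suc max_def abs_if split: if_splits)
    have 2: "\<exists>i\<le>Suc k. low c x (Suc k) + up c (\<lambda>i. - x i) (Suc k) \<le> W i - x i"
    proof (cases "low c x (Suc k) = up c x (Suc k) - x (Suc k)")
      case True
      then show ?thesis using 1 by (intro exI[of _ "Suc k"]) auto
    next
      \<comment> \<open>Here \<open>low\<close> keeps its value. By the coupling inequality a rise
        of up' would force \<open>low\<close> to rise, so up' is unchanged as well and the old
        witness remains valid.\<close>
      case False
      then show ?thesis using ij inv \<open>0 \<le> c\<close>
        by (intro exI[of _ i]) (auto simp: up_Suc low_Suc max_def split: if_splits)
    qed
    have 3: "\<exists>i\<le>Suc k. low c (\<lambda>i. - x i) (Suc k) + up c x (Suc k) \<le> W i + x i"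
    proof (cases "low c (\<lambda>i. - x i) (Suc k) = up c (\<lambda>i. - x i) (Suc k) + x (Suc k)")
      case True
      then show ?thesis using 1 by (intro exI[of _ "Suc k"]) auto
    next
      case False
      then show ?thesis using ij inv \<open>0 \<le> c\<close>
        by (intro exI[of _ j]) (auto simp: up_Suc low_Suc max_def split: if_splits)
    qed
    from 1 2 3 show ?case by blast
  qed
  then show "k \<le> N \<Longrightarrow> up c x k + up c (\<lambda>i. - x i) k \<le> W k" by blast
qed

section \<open>Regularity of the truncated variations of a cadlag function\<close>

text \<open>Near \<open>x\<close> a step function with one jump at \<open>x\<close> works, and two majorants on adjacent
  intervals are glued with an additional jump \<open>c\<close>.\<close>

lemma cadlag_superadd_majorant:
  assumes "a \<le> b" "cadlag_on a b f" "0 < c"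
  shows "\<exists>W. \<forall>u v. a \<le> u \<and> u \<le> v \<and> v \<le> b \<longrightarrow> W u + max (\<bar>f v - f u\<bar> - c) 0 \<le> (W v :: real)"
proof -
  define P where "P s t \<longleftrightarrow> (\<exists>W. \<forall>u v. s \<le> u \<and> u \<le> v \<and> v \<le> t \<and> a \<le> u \<and> v \<le> b
      \<longrightarrow> W u + max (\<bar>f v - f u\<bar> - c) 0 \<le> (W v :: real))" for s t
  \<comment> \<open>Compactness enters through the Bolzano principle: \<open>P\<close> holds on
    short intervals around each point and passes to concatenated intervals.\<close>
  have "P a b"
    using \<open>a \<le> b\<close>
  proof (induct rule: Bolzano)
    case (trans r s t)
    obtain W W' where
      W: "\<And>u v. r \<le> u \<Longrightarrow> u \<le> v \<Longrightarrow> v \<le> s \<Longrightarrow> a \<le> u \<Longrightarrow> v \<le> b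
            \<Longrightarrow> W u + max (\<bar>f v - f u\<bar> - c) 0 \<le> W v" and
      W': "\<And>u v. s \<le> u \<Longrightarrow> u \<le> v \<Longrightarrow> v \<le> t \<Longrightarrow> a \<le> u \<Longrightarrow> v \<le> b
            \<Longrightarrow> W' u + max (\<bar>f v - f u\<bar> - c) 0 \<le> W' v"
      using trans(1,2) unfolding P_def by blast
    \<comment> \<open>The extra \<open>c\<close> pays for an increment across \<open>s\<close>: the
      kernel at p + q exceeds the sum of its values at p and q by at most \<open>c\<close>.\<close>
    define X where "X v = (if v \<le> s then W v else W s + c + W' v - W' s)" for v
    have "X u + max (\<bar>f v - f u\<bar> - c) 0 \<le> X v"
      if "r \<le> u" "u \<le> v" "v \<le> t" "a \<le> u" "v \<le> b" for u v
    proof -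
      consider "v \<le> s" | "u \<le> s" "s < v" | "s < u" by linarith
      then show ?thesis
      proof cases
        case 1
        then show ?thesis using W[of u v] that by (simp add: X_def)
      next
        case 2
        then show ?thesis using W[of u s] W'[of s v] that \<open>0 < c\<close> by (simp add: X_def)
      next
        case 3
        then show ?thesis using W'[of u v] that by (simp add: X_def)
      qed
    qed
    then show ?case unfolding P_def by blast
  next
    case (local x)
    have "\<exists>d>0. \<forall>v. x < v \<and> v < x + d \<and> v \<le> b \<longrightarrow> \<bar>f v - f x\<bar> < c / 2"
    proof (cases "x < b")
      case True
      then have "(f \<longlongrightarrow> f x) (at_right x)" using assms local by (auto simp: cadlag_on_def)
      then have "eventually (\<lambda>v. dist (f v) (f x) < c / 2) (at_right x)"
        using \<open>0 < c\<close> by (intro tendstoD) auto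
      then obtain y where "y > x" "\<forall>v>x. v < y \<longrightarrow> dist (f v) (f x) < c / 2"
        by (auto simp: eventually_at_right_field)
      then show ?thesis by (intro exI[of _ "y - x"]) (auto simp: dist_real_def)
    qed (auto intro!: exI[of _ 1])
    then obtain d where d: "d > 0" "\<And>v. x < v \<Longrightarrow> v < x + d \<Longrightarrow> v \<le> b \<Longrightarrow> \<bar>f v - f x\<bar> < c / 2"
      by blast
    have "\<exists>l. \<exists>d>0. \<forall>v. v < x \<and> x - d < v \<and> a \<le> v \<longrightarrow> \<bar>f v - l\<bar> < c / 2"
    proof (cases "a < x")
      case True
      then have "x \<in> {a<..b}" using local by simp
      then obtain l where "(f \<longlongrightarrow> l) (at_left x)" using assms(2) unfolding cadlag_on_def by blast
      then have "eventually (\<lambda>v. dist (f v) l < c / 2) (at_left x)"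
        using \<open>0 < c\<close> by (intro tendstoD) auto
      then obtain y where "y < x" "\<forall>v>y. v < x \<longrightarrow> dist (f v) l < c / 2"
        by (auto simp: eventually_at_left_field)
      then show ?thesis by (intro exI[of _ l] exI[of _ "x - y"]) (auto simp: dist_real_def)
    qed (auto intro!: exI[of _ 1])
    then obtain l d' where d': "d' > 0" "\<And>v. v < x \<Longrightarrow> x - d' < v \<Longrightarrow> a \<le> v \<Longrightarrow> \<bar>f v - l\<bar> < c / 2"
      by blast
    \<comment> \<open>On either side of \<open>x\<close> the values stay within \<open>c / 2\<close>
      of \<open>l\<close> or of \<open>f x\<close>, so the kernel vanishes there; an increment
      across \<open>x\<close> exceeds \<open>\<bar>f x - l\<bar>\<close> by less than
      \<open>c\<close>.\<close>
    define W where "W v = (if v < x then 0 else \<bar>f x - l\<bar>)" for v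
    have "P s t" if st: "s \<le> x \<and> x \<le> t \<and> t - s < min d d'" for s t
      unfolding P_def
    proof (intro exI[of _ W] allI impI)
      fix u v assume uv: "s \<le> u \<and> u \<le> v \<and> v \<le> t \<and> a \<le> u \<and> v \<le> b"
      have L: "\<bar>f z - l\<bar> < c / 2" if "z \<in> {u, v}" "z < x" for z
        using that uv st by (intro d') auto
      have R: "\<bar>f z - f x\<bar> < c / 2" if "z \<in> {u, v}" "x \<le> z" for z
      proof (cases "z = x")
        case False
        then show ?thesis using that uv st by (intro d) auto
      qed (use \<open>0 < c\<close> in simp)
      consider "v < x" | "u < x" "x \<le> v" | "x \<le> u" by linarith
      then show "W u + max (\<bar>f v - f u\<bar> - c) 0 \<le> W v"
      proof cases
        case 1
        then have "\<bar>f u - l\<bar> < c / 2" "\<bar>f v - l\<bar> < c / 2" using L uv by auto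
        then have "\<bar>f v - f u\<bar> \<le> c" by linarith
        then show ?thesis using 1 uv by (simp add: W_def)
      next
        case 2
        then have "\<bar>f u - l\<bar> < c / 2" "\<bar>f v - f x\<bar> < c / 2" using L R by auto
        then have "\<bar>f v - f u\<bar> - c \<le> \<bar>f x - l\<bar>" by linarith
        then show ?thesis using 2 by (simp add: W_def)
      next
        case 3
        then have "\<bar>f u - f x\<bar> < c / 2" "\<bar>f v - f x\<bar> < c / 2" using R uv by auto
        then have "\<bar>f v - f u\<bar> \<le> c" by linarith
        then show ?thesis using 3 uv by (simp add: W_def)
      qed
    qed
    then show ?case using d d' by (intro exI[of _ "min d d'"]) auto
  qed
  then show ?thesis unfolding P_def by blast
qed

text \<open>The conditions hold for the kernels of \<open>UTVc\<close> and \<open>TVc\<close>, and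
  with \<open>- f\<close> for \<open>DTVc\<close>, so finiteness and regularity are shown once for
  all three.\<close>

locale truncated_variation =
  fixes a b c :: real and f \<phi> :: "real \<Rightarrow> real"
  assumes ab: "a < b" and cadlag: "cadlag_on a b f" and c_pos: "0 < c"
    and kernel_nonneg: "0 \<le> \<phi> x" and kernel_le: "\<phi> x \<le> max (\<bar>x\<bar> - c) 0"
    and kernel_Lipschitz: "\<phi> (x + y) \<le> \<phi> x + \<bar>y\<bar>"
begin

lemma kernel_eq_0: "\<bar>x\<bar> \<le> c \<Longrightarrow> \<phi> x = 0"
  using kernel_nonneg[of x] kernel_le[of x] by simp

text \<open>Clamping the argument to \<open>[a; b]\<close> makes \<open>var\<close> monotone and
  right-continuous on the whole line, as a distribution function for \<open>interval_measure\<close>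
  has to be.\<close>

definition "var s = real_of_ereal (incr_var \<phi> f a (max a (min b s)))"

text \<open>Finiteness: a superadditive majorant, shifted to vanish at \<open>a\<close>, bounds the
  supremum, so the conversion to a real number loses nothing.\<close>

lemma incr_var_eq_var:
  assumes "a \<le> s" "s \<le> b"
  shows "incr_var \<phi> f a s = ereal (var s)"
proof -
  obtain W where W: "\<And>u v. a \<le> u \<Longrightarrow> u \<le> v \<Longrightarrow> v \<le> b \<Longrightarrow> W u + max (\<bar>f v - f u\<bar> - c) 0 \<le> W v"
    using cadlag_superadd_majorant[of a b f c] ab cadlag c_pos by auto
  have "incr_var \<phi> f a s \<le> ereal (W s - W a)"
  proof (rule incr_var_le_superadd)
    show "W u - W a + \<phi> (f v - f u) \<le> W v - W a" if "a \<le> u" "u \<le> v" "v \<le> s" for u v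
      using W[of u v] kernel_le[of "f v - f u"] that assms by simp
  qed (use kernel_nonneg in auto)
  moreover have "0 \<le> incr_var \<phi> f a s" using assms by (intro incr_var_nonneg)
  ultimately have "\<bar>incr_var \<phi> f a s\<bar> \<noteq> \<infinity>" by auto
  then show ?thesis using assms by (simp add: var_def ereal_real min_def max_def)
qed

lemma var_clamp: "var (max a (min b s)) = var s"
  using ab by (simp add: var_def)

lemma var_left_end: "var a = 0"
  using incr_var_at_left_end[of \<phi> f a] kernel_nonneg kernel_eq_0[of 0] c_pos ab by (simp add: var_def)

lemma var_superadd:
  assumes "a \<le> u" "u \<le> v" "v \<le> b"
  shows "var u + \<phi> (f v - f u) \<le> var v"
  using incr_var_superadd[of \<phi> a u v f] assms kernel_nonneg kernel_eq_0[of 0] c_pos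
  by (simp add: incr_var_eq_var)

lemma var_mono:
  assumes "u \<le> v"
  shows "var u \<le> var v"
proof -
  have "a \<le> max a (min b u)" "max a (min b u) \<le> max a (min b v)" "max a (min b v) \<le> b"
    using assms ab by auto
  from var_superadd[OF this] show ?thesis
    using kernel_nonneg[of "f (max a (min b v)) - f (max a (min b u))"] by (simp only: var_clamp)
qed

lemma var_le_superadd:
  assumes "\<And>u v. a \<le> u \<Longrightarrow> u \<le> v \<Longrightarrow> v \<le> s \<Longrightarrow> W u + \<phi> (f v - f u) \<le> W v" "0 \<le> W a" "a \<le> s" "s \<le> b"
  shows "var s \<le> W s"
  using incr_var_le_superadd[of a s W \<phi> f] assms kernel_nonneg by (simp add: incr_var_eq_var)

text \<open>Increments of \<open>f\<close> inside \<open>[s; t]\<close> are at most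
  \<open>2 * e \<le> c\<close>, where the kernel vanishes. Only a partition interval crossing
  \<open>s\<close> counts, and cutting it off at \<open>s\<close> changes the kernel by at most
  \<open>e\<close>; hence a majorant that jumps by \<open>e\<close> after \<open>s\<close> and then
  stays constant.\<close>

lemma var_increment_le:
  assumes "a \<le> s" "s \<le> t" "t \<le> b" "\<And>u. s \<le> u \<Longrightarrow> u \<le> t \<Longrightarrow> \<bar>f u - f s\<bar> \<le> e" "2 * e \<le> c"
  shows "var t \<le> var s + e"
proof (cases "s = t")
  case True
  then show ?thesis using assms(4)[of s] by simp
next
  case False
  define W where "W v = (if v \<le> s then var v else var s + e)" for v
  have "var t \<le> W t"
  proof (rule var_le_superadd)
    show "W u + \<phi> (f v - f u) \<le> W v" if "a \<le> u" "u \<le> v" "v \<le> t" for u v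
    proof -
      consider "v \<le> s" | "u \<le> s" "s < v" | "s < u" by linarith
      then show ?thesis
      proof cases
        case 1
        then show ?thesis using var_superadd[of u v] that assms by (simp add: W_def)
      next
        case 2
        then show ?thesis
          using var_superadd[of u s] kernel_Lipschitz[of "f s - f u" "f v - f s"] that assms(1-3) assms(4)[of v]
          by (simp add: W_def)
      next
        case 3
        then have "\<phi> (f v - f u) = 0"
          using assms(4)[of u] assms(4)[of v] assms(5) that by (intro kernel_eq_0) auto
        then show ?thesis using 3 that by (simp add: W_def)
      qed
    qed
  qed (use assms var_left_end in \<open>auto simp: W_def\<close>)
  then show ?thesis using False assms by (simp add: W_def)
qed

text \<open>For \<open>x\<close> in \<open>[a; b)\<close>, \<open>var_increment_le\<close> carries
  right continuity over from \<open>f\<close>; elsewhere the clamped function is constant just to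
  the right of \<open>x\<close>.\<close>

lemma var_right_cont: "continuous (at_right x) var"
  unfolding continuous_within
proof (rule tendstoI)
  fix e :: real assume e: "0 < e"
  show "eventually (\<lambda>y. dist (var y) (var x) < e) (at_right x)"
  proof (cases "a \<le> x \<and> x < b")
    case True
    define e' where "e' = min (e / 2) (c / 2)"
    have e': "0 < e'" "2 * e' \<le> c" "e' < e" using e c_pos by (auto simp: e'_def)
    have "(f \<longlongrightarrow> f x) (at_right x)" using True cadlag by (auto simp: cadlag_on_def)
    then have "eventually (\<lambda>v. dist (f v) (f x) < e') (at_right x)" using e' by (intro tendstoD)
    then obtain y where y: "y > x" "\<And>v. v > x \<Longrightarrow> v < y \<Longrightarrow> \<bar>f v - f x\<bar> < e'"
      by (auto simp: eventually_at_right_field dist_real_def)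
    have "dist (var v) (var x) < e" if "v > x" "v < min y b" for v
    proof -
      have "\<bar>f u - f x\<bar> \<le> e'" if "x \<le> u" "u \<le> v" for u
        using y(2)[of u] that \<open>v < min y b\<close> e'(1) by (cases "u = x") auto
      then have "var v \<le> var x + e'" using True that e' by (intro var_increment_le) auto
      then show ?thesis using var_mono[of x v] that e' by (simp add: dist_real_def)
    qed
    then show ?thesis
      using y True by (auto simp: eventually_at_right_field intro!: exI[of _ "min y b"])
  next
    case False
    have "var y = var x" if "y > x" "x \<ge> b \<or> y < a" for y
      using that ab by (auto simp: var_def min_def max_def)
    then have "\<And>v. v > x \<Longrightarrow> v < (if x \<ge> b then x + 1 else a) \<Longrightarrow> dist (var v) (var x) < e"
      using e by (metis dist_self)
    moreover have "x < (if x \<ge> b then x + 1 else a)" using False by auto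
    ultimately show ?thesis unfolding eventually_at_right_field by blast
  qed
qed

lemma var_continuous:
  assumes "t \<in> {a..b}" "continuous (at t within {a..b}) f"
  shows "continuous (at t within {a..b}) var"
  unfolding continuous_within_eps_delta
proof (intro allI impI)
  fix e :: real assume e: "0 < e"
  \<comment> \<open>The bound \<open>var_increment_le\<close> compares with the left end of the
    interval. If that end is \<open>y\<close> and not \<open>t\<close>, the error doubles; hence
    quarters.\<close>
  define e' where "e' = min (e / 4) (c / 4)"
  have e': "0 < e'" "4 * e' \<le> c" "2 * e' < e" using e c_pos by (auto simp: e'_def)
  obtain d where d: "d > 0" "\<And>y. y \<in> {a..b} \<Longrightarrow> dist y t < d \<Longrightarrow> \<bar>f y - f t\<bar> < e'"
    using assms(2) e'(1) unfolding continuous_within_eps_delta dist_real_def by blast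
  have "dist (var y) (var t) < e" if y: "y \<in> {a..b}" "dist y t < d" for y
  proof (cases "t \<le> y")
    case True
    have "\<bar>f u - f t\<bar> \<le> 2 * e'" if "t \<le> u" "u \<le> y" for u
      using d(2)[of u] y that assms(1) e' by (auto simp: dist_real_def)
    then have "var y \<le> var t + 2 * e'" using True y assms e' by (intro var_increment_le) auto
    then show ?thesis using var_mono[OF True] e' by (simp add: dist_real_def)
  next
    case False
    have "\<bar>f u - f y\<bar> \<le> 2 * e'" if "y \<le> u" "u \<le> t" for u
      using d(2)[of u] d(2)[of y] y that assms(1) e' by (auto simp: dist_real_def)
    then have "var t \<le> var y + 2 * e'" using False y assms e' by (intro var_increment_le) auto
    then show ?thesis using var_mono[of y t] False e' by (simp add: dist_real_def)
  qed
  then show "\<exists>d>0. \<forall>y\<in>{a..b}. dist y t < d \<longrightarrow> dist (var y) (var t) < e" using d(1) by blast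
qed

lemma var_left_limit: "\<exists>l. (var \<longlongrightarrow> l) (at_left x)"
proof -
  have "(var \<longlongrightarrow> (SUP y\<in>{..<x}. var y)) (at_left x)"
  proof (rule increasing_tendsto)
    have bdd: "bdd_above (var ` {..<x})" using var_mono by (intro bdd_aboveI[of _ "var x"]) auto
    show "eventually (\<lambda>n. var n \<le> (SUP y\<in>{..<x}. var y)) (at_left x)"
      using bdd by (auto simp: eventually_at_left_field intro!: cSUP_upper exI[of _ "x - 1"])
    fix r assume "r < (SUP y\<in>{..<x}. var y)"
    then obtain y where "y < x" "r < var y"
      using less_cSUP_iff[OF _ bdd, of r] by auto
    then show "eventually (\<lambda>n. r < var n) (at_left x)"
      using var_mono unfolding eventually_at_left_field by (meson less_le_trans less_imp_le)
  qed
  then show ?thesis by blast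
qed

end

section \<open>Passage from grids to the interval\<close>

text \<open>The partition points are grid points, and superadditivity of \<open>up\<close> between
  the indices of consecutive ones covers the grid points skipped over.\<close>

lemma partition_sum_le_up:
  assumes t: "t \<in> partitions a (T k) n" and rng: "\<And>i. i \<le> n \<Longrightarrow> t i \<in> T ` {..<N}"
    and T: "strict_mono_on {..<N} T" and "k < N" "0 \<le> c"
  shows "(\<Sum>i=1..n. max (g (t i) - g (t (i - 1)) - c) 0) \<le> up c (\<lambda>i. g (T i)) k"
proof -
  have m: "strict_mono_on {..n} t" and tn: "t n \<le> T k" using t by (auto simp: partitions_def)
  have "m \<le> n \<Longrightarrow> j < N \<Longrightarrow> t m = T j \<Longrightarrow>
      (\<Sum>i=1..m. max (g (t i) - g (t (i - 1)) - c) 0) \<le> up c (\<lambda>i. g (T i)) j" for m j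
  proof (induction m arbitrary: j)
    case 0
    then show ?case using up_mono[of 0 j c "\<lambda>i. g (T i)"] by (simp add: up_0)
  next
    case (Suc m)
    obtain i where i: "i < N" "t m = T i" using rng[of m] Suc.prems by auto
    have "T i < T j" using strict_mono_onD[OF m, of m "Suc m"] Suc.prems i by auto
    then have "i \<le> j" using strict_mono_on_less[OF T, of i j] i Suc.prems by auto
    then show ?case
      using Suc.IH[of i] i Suc.prems up_superadd[OF \<open>0 \<le> c\<close>, of i j "\<lambda>i. g (T i)"] by simp
  qed
  moreover obtain j where j: "j < N" "t n = T j" using rng[of n] by auto
  moreover have "j \<le> k" using strict_mono_on_less_eq[OF T, of j k] j tn \<open>k < N\<close> by auto
  ultimately show ?thesis using up_mono[of j k c "\<lambda>i. g (T i)"] by fastforce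
qed

locale cadlag_function =
  fixes a b c :: real and f :: "real \<Rightarrow> real"
  assumes ab: "a < b" and cadlag: "cadlag_on a b f" and c_pos: "0 < c"
begin

lemma cadlag_minus: "cadlag_on a b (\<lambda>t. - f t)"
  using cadlag tendsto_minus unfolding cadlag_on_def by metis

sublocale U: truncated_variation a b c f "\<lambda>x. max (x - c) 0"
  using ab cadlag c_pos by unfold_locales (auto simp: max_def)

sublocale D: truncated_variation a b c "\<lambda>t. - f t" "\<lambda>x. max (x - c) 0"
  using ab cadlag_minus c_pos by unfold_locales (auto simp: max_def)

sublocale V: truncated_variation a b c f "\<lambda>x. max (\<bar>x\<bar> - c) 0"
  using ab cadlag c_pos by unfold_locales (auto simp: max_def)

lemma UTVc_eq: "a \<le> s \<Longrightarrow> s \<le> b \<Longrightarrow> UTVc c f a s = ereal (U.var s)"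
  by (simp add: UTVc_eq_incr_var U.incr_var_eq_var)

lemma DTVc_eq: "a \<le> s \<Longrightarrow> s \<le> b \<Longrightarrow> DTVc c f a s = ereal (D.var s)"
  by (simp add: DTVc_eq_UTVc UTVc_eq_incr_var D.incr_var_eq_var)

lemma TVc_eq: "a \<le> s \<Longrightarrow> s \<le> b \<Longrightarrow> TVc c f a s = ereal (V.var s)"
  by (simp add: TVc_eq_incr_var V.incr_var_eq_var)

end

lemma (in truncated_variation) var_approx:
  assumes "a \<le> s" "s \<le> b" "0 < e"
  obtains n t where "t \<in> partitions a s n" "var s - e < (\<Sum>i=1..n. \<phi> (f (t i) - f (t (i - 1))))"
proof -
  have "ereal (var s - e) < incr_var \<phi> f a s" using assms by (simp add: incr_var_eq_var)
  then show ?thesis unfolding incr_var_def less_SUP_iff using that by auto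
qed

context cadlag_function
begin

text \<open>Four near-optimal partitions are merged with \<open>s\<close> and \<open>t\<close> into
  one grid, on which \<open>up\<close> lies between the partition sums and \<open>var\<close>. As
  \<open>up\<close> at index \<open>k\<close> sees only grid points up to \<open>s\<close>, one grid
  serves both times.\<close>

lemma grid_approx:
  assumes "a \<le> s" "s \<le> t" "t \<le> b" "0 < e"
  obtains T k m where "k \<le> m" "T k = s" "T m = t"
    "\<And>i j. i \<le> j \<Longrightarrow> j \<le> m \<Longrightarrow> a \<le> T i \<and> T i \<le> T j \<and> T j \<le> b"
    "\<bar>U.var s - up c (\<lambda>i. f (T i)) k\<bar> \<le> e" "\<bar>U.var t - up c (\<lambda>i. f (T i)) m\<bar> \<le> e"
    "\<bar>D.var s - up c (\<lambda>i. - f (T i)) k\<bar> \<le> e" "\<bar>D.var t - up c (\<lambda>i. - f (T i)) m\<bar> \<le> e"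
proof -
  have as: "a \<le> s" "s \<le> b" "a \<le> t" "t \<le> b" using assms by auto
  obtain n1 p1 where p1: "p1 \<in> partitions a s n1"
      "U.var s - e < (\<Sum>i=1..n1. max (f (p1 i) - f (p1 (i - 1)) - c) 0)"
    using U.var_approx[OF as(1) as(2) \<open>0 < e\<close>] by blast
  obtain n2 p2 where p2: "p2 \<in> partitions a t n2"
      "U.var t - e < (\<Sum>i=1..n2. max (f (p2 i) - f (p2 (i - 1)) - c) 0)"
    using U.var_approx[OF as(3) as(4) \<open>0 < e\<close>] by blast
  obtain n3 p3 where p3: "p3 \<in> partitions a s n3"
      "D.var s - e < (\<Sum>i=1..n3. max (- f (p3 i) - - f (p3 (i - 1)) - c) 0)"
    using D.var_approx[OF as(1) as(2) \<open>0 < e\<close>] by blast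
  obtain n4 p4 where p4: "p4 \<in> partitions a t n4"
      "D.var t - e < (\<Sum>i=1..n4. max (- f (p4 i) - - f (p4 (i - 1)) - c) 0)"
    using D.var_approx[OF as(3) as(4) \<open>0 < e\<close>] by blast
  have rng: "p ` {..n} \<subseteq> {a..b}" if "p \<in> partitions a r n" "r \<le> b" for p n r
  proof -
    have m: "strict_mono_on {..n} p" and "a \<le> p 0" "p n \<le> r" using that by (auto simp: partitions_def)
    then show ?thesis
      using strict_mono_on_leD[OF m, of _ n] strict_mono_on_leD[OF m, of 0] that by fastforce
  qed
  define F where "F = {s, t} \<union> p1 ` {..n1} \<union> p2 ` {..n2} \<union> p3 ` {..n3} \<union> p4 ` {..n4}"
  have "finite F" by (simp add: F_def)
  have F: "F \<subseteq> {a..b}"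
    using rng[OF p1(1)] rng[OF p2(1)] rng[OF p3(1)] rng[OF p4(1)] assms by (auto simp: F_def)
  define T where "T i = sorted_list_of_set F ! i" for i
  have len: "length (sorted_list_of_set F) = card F" by simp
  have T: "strict_mono_on {..<card F} T"
    using sorted_wrt_nth_less[OF strict_sorted_list_of_set[of F]]
    by (intro strict_mono_onI) (simp add: T_def)
  have TF: "T ` {..<card F} = F"
  proof -
    have "set (sorted_list_of_set F) = F" using \<open>finite F\<close> by simp
    then show ?thesis unfolding set_conv_nth len by (auto simp: T_def image_def)
  qed
  have "s \<in> T ` {..<card F}" "t \<in> T ` {..<card F}" unfolding TF by (simp_all add: F_def)
  then obtain k m where k: "k < card F" "T k = s" and m: "m < card F" "T m = t" by auto
  have "k \<le> m" using strict_mono_on_less_eq[OF T, of k m] k m assms by auto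
  have Trng: "a \<le> T i \<and> T i \<le> T j \<and> T j \<le> b" if "i \<le> j" "j \<le> m" for i j
  proof -
    have "T ` {i, j} \<subseteq> T ` {..<card F}" using that m by (intro image_mono) auto
    then have "T i \<in> {a..b}" "T j \<in> {a..b}" using F unfolding TF by auto
    then show ?thesis using strict_mono_on_leD[OF T, of i j] that m by auto
  qed
  \<comment> \<open>On the grid \<open>U.var\<close> and \<open>D.var\<close> are superadditive,
    hence lie above the least such sequences.\<close>
  have W: "up c (\<lambda>i. f (T i)) j \<le> U.var (T j)" "up c (\<lambda>i. - f (T i)) j \<le> D.var (T j)" if "j \<le> m" for j
  proof -
    have 0: "0 \<le> U.var (T 0)" "0 \<le> D.var (T 0)"
      using U.var_mono[of a "T 0"] D.var_mono[of a "T 0"] Trng[of 0 m] by (auto simp: U.var_left_end D.var_left_end)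
    show "up c (\<lambda>i. f (T i)) j \<le> U.var (T j)"
      using that Trng by (intro up_le_superadd[where N=m and W="\<lambda>i. U.var (T i)"] U.var_superadd 0) auto
    show "up c (\<lambda>i. - f (T i)) j \<le> D.var (T j)"
      using that Trng by (intro up_le_superadd[where N=m and W="\<lambda>i. D.var (T i)"] D.var_superadd 0) auto
  qed
  have mem: "p1 i \<in> T ` {..<card F}" if "i \<le> n1" for i using that unfolding TF by (auto simp: F_def)
  have mem2: "p2 i \<in> T ` {..<card F}" if "i \<le> n2" for i using that unfolding TF by (auto simp: F_def)
  have mem3: "p3 i \<in> T ` {..<card F}" if "i \<le> n3" for i using that unfolding TF by (auto simp: F_def)
  have mem4: "p4 i \<in> T ` {..<card F}" if "i \<le> n4" for i using that unfolding TF by (auto simp: F_def)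
  note c = less_imp_le[OF c_pos]
  have "U.var s - e < up c (\<lambda>i. f (T i)) k"
    using partition_sum_le_up[where g=f, OF p1(1)[folded k(2)] mem T k(1) c] p1(2) by linarith
  moreover have "U.var t - e < up c (\<lambda>i. f (T i)) m"
    using partition_sum_le_up[where g=f, OF p2(1)[folded m(2)] mem2 T m(1) c] p2(2) by linarith
  moreover have "D.var s - e < up c (\<lambda>i. - f (T i)) k"
    using partition_sum_le_up[where g="\<lambda>t. - f t", OF p3(1)[folded k(2)] mem3 T k(1) c] p3(2) by linarith
  moreover have "D.var t - e < up c (\<lambda>i. - f (T i)) m"
    using partition_sum_le_up[where g="\<lambda>t. - f t", OF p4(1)[folded m(2)] mem4 T m(1) c] p4(2) by linarith
  ultimately show thesis
    using that[OF \<open>k \<le> m\<close> k(2) m(2) Trng] W[of k] W[of m] k m \<open>k \<le> m\<close> by auto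
qed

text \<open>This is the limit of \<open>up_diff_osc\<close> over grids containing \<open>s\<close>
  and \<open>t\<close>; four approximations enter, each with error \<open>e / 4\<close>.\<close>

lemma var_diff_osc:
  assumes "a \<le> s" "s \<le> t" "t \<le> b"
  shows "\<bar>(U.var t - D.var t - f t) - (U.var s - D.var s - f s)\<bar> \<le> c"
proof (rule field_le_epsilon)
  fix e :: real assume "0 < e"
  then have "0 < e / 4" by simp
  show "\<bar>(U.var t - D.var t - f t) - (U.var s - D.var s - f s)\<bar> \<le> c + e"
  proof (rule grid_approx[OF assms \<open>0 < e / 4\<close>])
    fix k m :: nat and T :: "nat \<Rightarrow> real"
    assume T: "k \<le> m" "T k = s" "T m = t"
      and approx: "\<bar>U.var s - up c (\<lambda>i. f (T i)) k\<bar> \<le> e / 4" "\<bar>U.var t - up c (\<lambda>i. f (T i)) m\<bar> \<le> e / 4"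
        "\<bar>D.var s - up c (\<lambda>i. - f (T i)) k\<bar> \<le> e / 4" "\<bar>D.var t - up c (\<lambda>i. - f (T i)) m\<bar> \<le> e / 4"
    have "0 \<le> c" using c_pos by simp
    from up_diff_osc[OF this T(1) order.refl, of "\<lambda>i. f (T i)"]
      up_diff_osc[OF this order.refl T(1), of "\<lambda>i. f (T i)"] approx
    show ?thesis unfolding T(2,3) by linarith
  qed
qed

text \<open>Along a grid \<open>V.var\<close> is superadditive for the two-sided kernel, so
  \<open>up_add_le_superadd\<close> applies; \<open>grid_approx\<close> is used with equal end
  points.\<close>

lemma var_add_le:
  assumes "a \<le> s" "s \<le> b"
  shows "U.var s + D.var s \<le> V.var s"
proof (rule field_le_epsilon)
  fix e :: real assume "0 < e"
  show "U.var s + D.var s \<le> V.var s + e"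
  proof (rule grid_approx[OF assms(1) order.refl assms(2) half_gt_zero[OF \<open>0 < e\<close>]])
    fix k m :: nat and T :: "nat \<Rightarrow> real"
    assume T: "T m = s" "\<And>i j. i \<le> j \<Longrightarrow> j \<le> m \<Longrightarrow> a \<le> T i \<and> T i \<le> T j \<and> T j \<le> b"
      and approx: "\<bar>U.var s - up c (\<lambda>i. f (T i)) m\<bar> \<le> e / 2" "\<bar>D.var s - up c (\<lambda>i. - f (T i)) m\<bar> \<le> e / 2"
    have "0 \<le> V.var (T 0)" using V.var_mono[of a "T 0"] T(2)[of 0 m] by (auto simp: V.var_left_end)
    then have "up c (\<lambda>i. f (T i)) m + up c (\<lambda>i. - f (T i)) m \<le> V.var (T m)"
      using T(2) c_pos
      by (intro up_add_le_superadd[where N=m and W="\<lambda>i. V.var (T i)"] V.var_superadd) auto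
    then show "U.var s + D.var s \<le> V.var s + e" using approx unfolding T(1) by linarith
  qed
qed

text \<open>This is the function \<open>f0\<close> of the theorem, and \<open>fc\<close> is a
  vertical translate of it.\<close>

definition "g t = U.var t - D.var t"

lemma osc_g: "s \<in> {a..b} \<Longrightarrow> t \<in> {a..b} \<Longrightarrow> \<bar>(g t - f t) - (g s - f s)\<bar> \<le> c"
  using var_diff_osc[of s t] var_diff_osc[of t s] by (cases "s \<le> t") (auto simp: g_def abs_minus_commute)

text \<open>The sum of two nondecreasing functions is a superadditive majorant for the absolute
  increments of their difference.\<close>

lemma TV_g_le:
  assumes "a \<le> s" "s \<le> b"
  shows "TV g a s \<le> ereal (U.var s + D.var s)"
  unfolding TV_eq_incr_var
proof (rule incr_var_le_superadd)
  show "U.var u + D.var u + \<bar>g v - g u\<bar> \<le> U.var v + D.var v" if "u \<le> v" for u v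
    using U.var_mono[OF that] D.var_mono[OF that] by (simp add: g_def)
qed (auto simp: U.var_left_end D.var_left_end)

end

text \<open>A perturbation of oscillation at most \<open>c\<close> shortens each increment by at
  most \<open>c\<close>. This is the lower bound for all competitors, \<open>g\<close>
  included.\<close>

lemma TVc_le_TV:
  assumes "\<And>u v. u \<in> {a..s} \<Longrightarrow> v \<in> {a..s} \<Longrightarrow> \<bar>(g v - f v) - (g u - f u)\<bar> \<le> c"
  shows "TVc c f a s \<le> TV g a s"
  unfolding TV_eq_incr_var TVc_eq_incr_var
proof (rule incr_var_mono, rule sum_mono)
  fix n i :: nat and t :: "nat \<Rightarrow> real"
  assume "\<And>i. i \<le> n \<Longrightarrow> t i \<in> {a..s}" "i \<in> {1..n}"
  then have "\<bar>(g (t i) - f (t i)) - (g (t (i - 1)) - f (t (i - 1)))\<bar> \<le> c" by (intro assms) auto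
  then show "max (\<bar>f (t i) - f (t (i - 1))\<bar> - c) 0 \<le> \<bar>g (t i) - g (t (i - 1))\<bar>" by linarith
qed

context cadlag_function
begin

text \<open>The inequalities form a cycle: TVc is at most TV g, which is at most UTVc + DTVc, which
  is at most TVc.\<close>

lemma TVc_eq_TV_g_and_add:
  assumes "a \<le> s" "s \<le> b"
  shows "TV g a s = TVc c f a s" "TVc c f a s = UTVc c f a s + DTVc c f a s"
proof -
  have "TVc c f a s \<le> TV g a s" using assms by (intro TVc_le_TV osc_g) auto
  moreover have "UTVc c f a s + DTVc c f a s \<le> TVc c f a s"
    using var_add_le[OF assms] by (simp add: UTVc_eq DTVc_eq TVc_eq assms)
  moreover have "TV g a s \<le> UTVc c f a s + DTVc c f a s"
    using TV_g_le[OF assms] by (simp add: UTVc_eq DTVc_eq assms)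
  ultimately show "TV g a s = TVc c f a s" "TVc c f a s = UTVc c f a s + DTVc c f a s"
    by (meson antisym order_trans)+
qed

lemma g_left_end: "g a = 0"
  by (simp add: g_def U.var_left_end D.var_left_end)

lemma cadlag_g: "cadlag_on a b g"
  unfolding cadlag_on_def
proof (intro conjI ballI)
  fix t
  show "(g \<longlongrightarrow> g t) (at_right t)"
    using U.var_right_cont[of t] D.var_right_cont[of t]
    unfolding continuous_within g_def by (intro tendsto_intros)
  obtain l l' where "(U.var \<longlongrightarrow> l) (at_left t)" "(D.var \<longlongrightarrow> l') (at_left t)"
    using U.var_left_limit D.var_left_limit by blast
  then have "(g \<longlongrightarrow> l - l') (at_left t)" unfolding g_def by (intro tendsto_intros)
  then show "\<exists>l. (g \<longlongrightarrow> l) (at_left t)" by blast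
qed

lemma continuous_g:
  "t \<in> {a..b} \<Longrightarrow> continuous (at t within {a..b}) f \<Longrightarrow> continuous (at t within {a..b}) g"
  unfolding g_def by (intro continuous_intros U.var_continuous D.var_continuous) auto

end

section \<open>Signed measures on a half-open interval\<close>

lemma restrict_interval_measure:
  fixes F :: "real \<Rightarrow> real"
  assumes mono: "mono F" and cont: "\<And>x. continuous (at_right x) F"
    and "a \<le> b"
  defines "M \<equiv> restrict_space (interval_measure F) {a<..b}"
  shows "sets M = sets (restrict_space borel {a<..b})" "finite_measure M"
    "\<And>u v. a \<le> u \<Longrightarrow> u \<le> v \<Longrightarrow> v \<le> b \<Longrightarrow> measure M {u<..v} = F v - F u"
proof -
  show "sets M = sets (restrict_space borel {a<..b})"
    by (simp add: M_def sets_restrict_space)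
  show "finite_measure M"
    by (rule finite_measureI)
      (simp add: M_def space_restrict_space emeasure_restrict_space emeasure_interval_measure_Ioc_eq monoD[OF mono] cont)
  show "measure M {u<..v} = F v - F u" if "a \<le> u" "u \<le> v" "v \<le> b" for u v
  proof -
    have "{u<..v} \<subseteq> {a<..b}" using that by auto
    then show ?thesis
      using that by (simp add: M_def measure_restrict_space measure_interval_measure_Ioc monoD[OF mono] cont)
  qed
qed

lemma finite_signed_measure_diff:
  assumes "finite_measure M" "finite_measure N" "sets M = sets L" "sets N = sets L"
  shows "finite_signed_measure L (\<lambda>A. measure M A - measure N A)"
  unfolding finite_signed_measure_def
proof (intro conjI allI impI)
  fix A :: "nat \<Rightarrow> 'a set"
  assume "range A \<subseteq> sets L" "disjoint_family A"
  then show "(\<lambda>n. measure M (A n) - measure N (A n)) sums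
      (measure M (\<Union>n. A n) - measure N (\<Union>n. A n))"
    using assms by (intro sums_diff finite_measure.finite_measure_UNION) auto
qed simp

text \<open>Continuing the two sets by empty sets gives a sequence to which countable additivity
  applies.\<close>

lemma finite_signed_measure_Un:
  assumes "finite_signed_measure M \<mu>" "A \<in> sets M" "B \<in> sets M" "A \<inter> B = {}"
  shows "\<mu> (A \<union> B) = \<mu> A + \<mu> B"
proof -
  have "range (binaryset A B) \<subseteq> sets M" "disjoint_family (binaryset A B)"
    using assms by (auto simp: range_binaryset_eq disjoint_family_on_def binaryset_def)
  then have "(\<lambda>n. \<mu> (binaryset A B n)) sums \<mu> (\<Union>n. binaryset A B n)"
    using assms(1) unfolding finite_signed_measure_def by blast
  moreover have "(\<lambda>n. \<mu> (binaryset A B n)) sums (\<mu> A + \<mu> B)"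
    using assms(1) by (intro binaryset_sums) (simp add: finite_signed_measure_def)
  ultimately show ?thesis by (metis UN_binaryset_eq sums_unique2)
qed

text \<open>The traces of a generator generate the trace sigma-algebra; an empty trace is written as
  \<open>{a<..a}\<close>.\<close>

lemma sets_restrict_borel_Ioc:
  fixes a b :: real
  assumes "a \<le> b"
  shows "sets (restrict_space borel {a<..b}) = sigma_sets {a<..b} {{u<..v} | u v. a \<le> u \<and> u \<le> v \<and> v \<le> b}"
proof -
  have "{a<..b} \<in> sigma_sets UNIV (range (\<lambda>(u, v). {u<..v}))" by (rule sigma_sets.Basic) auto
  from sigma_sets_Int[OF this] have
    "sets (restrict_space borel {a<..b}) = sigma_sets {a<..b} ((\<inter>) {a<..b} ` range (\<lambda>(u, v). {u<..v}))"
    by (simp add: sets_restrict_space borel_sigma_sets_Ioc)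
  also have "(\<inter>) {a<..b} ` range (\<lambda>(u, v). {u<..v}) = {{u<..v} | u v. a \<le> u \<and> u \<le> v \<and> v \<le> b}"
  proof (intro equalityI subsetI)
    fix A assume "A \<in> (\<inter>) {a<..b} ` range (\<lambda>(u, v). {u<..v})"
    then obtain u v where A: "A = {max a u<..min b v}" by auto
    show "A \<in> {{u<..v} | u v. a \<le> u \<and> u \<le> v \<and> v \<le> b}"
    proof (cases "max a u \<le> min b v")
      case True
      moreover have "a \<le> max a u" "min b v \<le> b" by auto
      ultimately show ?thesis using A by blast
    next
      case False
      then have "A = {a<..a}" using A by auto
      then show ?thesis using assms by blast
    qed
  next
    fix A assume "A \<in> {{u<..v} | u v. a \<le> u \<and> u \<le> v \<and> v \<le> b}"
    then obtain u v where "A = {u<..v}" "a \<le> u" "v \<le> b" by auto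
    then have "A = {a<..b} \<inter> (\<lambda>(u, v). {u<..v}) (u, v)" by auto
    then show "A \<in> (\<inter>) {a<..b} ` range (\<lambda>(u, v). {u<..v})" by blast
  qed
  finally show ?thesis .
qed

text \<open>Dynkin's argument on the intersection-stable system of half-open intervals. The
  complement step subtracts from the value on \<open>{a<..b}\<close>, itself a generator.\<close>

lemma finite_signed_measure_eqI:
  fixes a b :: real
  defines "M \<equiv> restrict_space borel {a<..b}"
  assumes "a \<le> b" and \<mu>: "finite_signed_measure M \<mu>" and \<nu>: "finite_signed_measure M \<nu>"
    and eq: "\<And>u v. a \<le> u \<Longrightarrow> u \<le> v \<Longrightarrow> v \<le> b \<Longrightarrow> \<mu> {u<..v} = \<nu> {u<..v}"
    and A: "A \<in> sets M"
  shows "\<mu> A = \<nu> A"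
proof -
  define G where "G = {{u<..v} | u v. a \<le> u \<and> u \<le> v \<and> v \<le> b}"
  have sets: "sets M = sigma_sets {a<..b} G"
    unfolding M_def G_def using \<open>a \<le> b\<close> by (rule sets_restrict_borel_Ioc)
  have S: "{a<..b} \<in> sets M" by (simp add: M_def sets_restrict_space_iff)
  have "Int_stable G"
  proof (rule Int_stableI)
    fix A B assume "A \<in> G" "B \<in> G"
    then obtain u v u' v' where *: "A = {u<..v}" "B = {u'<..v'}" "a \<le> u" "u \<le> v" "v \<le> b" "a \<le> u'" "u' \<le> v'" "v' \<le> b"
      unfolding G_def by blast
    \<comment> \<open>The outer \<open>max\<close> at the right end keeps the end points ordered
      when the intersection is empty.\<close>
    then have "A \<inter> B = {max u u'<..max (max u u') (min v v')}" by auto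
    moreover have "a \<le> max u u'" "max (max u u') (min v v') \<le> b" using * by auto
    ultimately show "A \<inter> B \<in> G" unfolding G_def by (metis (mono_tags, lifting) max.cobounded1 mem_Collect_eq)
  qed
  moreover have "G \<subseteq> Pow {a<..b}" by (auto simp: G_def)
  moreover have "A \<in> sigma_sets {a<..b} G" using A sets by simp
  ultimately show ?thesis
  proof (induct rule: sigma_sets_induct_disjoint)
    case (basic A)
    then show ?case using eq by (auto simp: G_def)
  next
    case empty
    then show ?case using \<mu> \<nu> by (simp add: finite_signed_measure_def)
  next
    case (compl A)
    have A: "A \<in> sets M" using compl sets by simp
    have "A \<subseteq> {a<..b}" using sets.sets_into_space[OF A] by (simp add: M_def)
    then have un: "A \<union> ({a<..b} - A) = {a<..b}" by blast
    have "\<mu> A + \<mu> ({a<..b} - A) = \<mu> {a<..b}"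
      using finite_signed_measure_Un[OF \<mu> A, of "{a<..b} - A"] S A un by auto
    moreover have "\<nu> A + \<nu> ({a<..b} - A) = \<nu> {a<..b}"
      using finite_signed_measure_Un[OF \<nu> A, of "{a<..b} - A"] S A un by auto
    ultimately show ?case using compl eq[of a b] \<open>a \<le> b\<close> by simp
  next
    case (union A)
    then have "range A \<subseteq> sets M" using sets by simp
    with union(1) have "(\<lambda>n. \<mu> (A n)) sums \<mu> (\<Union>n. A n)" "(\<lambda>n. \<nu> (A n)) sums \<nu> (\<Union>n. A n)"
      using \<mu> \<nu> unfolding finite_signed_measure_def by blast+
    then show ?case using union(3) by (metis (no_types, lifting) sums_cong sums_unique2)
  qed
qed

text \<open>If the total variation of the distribution function equals the sum of the total masses,
  a Hahn set of the difference carries no mass of the one measure, and its complement no mass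
  of the other one.\<close>

lemma hahn_jordan_of_TV:
  fixes a b :: real
  defines "L \<equiv> restrict_space borel {a<..b}"
  assumes "a \<le> b" and fin: "finite_measure M" "finite_measure N" and sets: "sets M = sets L" "sets N = sets L"
    and g: "\<And>u v. a \<le> u \<Longrightarrow> u \<le> v \<Longrightarrow> v \<le> b \<Longrightarrow> g v - g u = measure M {u<..v} - measure N {u<..v}"
    and TV: "ereal (measure M {a<..b} + measure N {a<..b}) \<le> TV g a b"
  shows "hahn_jordan L (\<lambda>A. measure M A - measure N A) M N"
proof -
  interpret M: finite_measure M by fact
  interpret N: finite_measure N by fact
  obtain Y where Y: "Y \<in> sets M"
    and Y1: "\<And>X. X \<in> sets M \<Longrightarrow> X \<subseteq> Y \<Longrightarrow> emeasure N X \<le> emeasure M X"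
    and Y2: "\<And>X. X \<in> sets M \<Longrightarrow> X \<inter> Y = {} \<Longrightarrow> emeasure M X \<le> emeasure N X"
    using finite_unsigned_Hahn_decomposition[OF fin] sets by metis
  have Y1': "measure N X \<le> measure M X" if "X \<in> sets M" "X \<subseteq> Y" for X
    using Y1[OF that] by (simp add: M.emeasure_eq_measure N.emeasure_eq_measure)
  have Y2': "measure M X \<le> measure N X" if "X \<in> sets M" "X \<inter> Y = {}" for X
    using Y2[OF that] by (simp add: M.emeasure_eq_measure N.emeasure_eq_measure)
  have Ioc: "{u<..v} \<in> sets M" if "a \<le> u" "v \<le> b" for u v
    using that by (auto simp: sets L_def sets_restrict_space_iff)
  have split: "measure M A = measure M (A \<inter> Y) + measure M (A - Y)"
    "measure N A = measure N (A \<inter> Y) + measure N (A - Y)" if "A \<in> sets M" for A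
    using that Y sets
      M.finite_measure_Union[of "A \<inter> Y" "A - Y"] N.finite_measure_Union[of "A \<inter> Y" "A - Y"]
    by (auto simp: Int_Diff_Un Int_Diff_disjoint)
  \<comment> \<open>\<open>W v\<close> is the mass on \<open>{a<..v}\<close> of the total variation
    measure of the difference, computed with the Hahn set \<open>Y\<close>; its increments dominate
    those of \<open>g\<close> in absolute value.\<close>
  define W where "W v = (measure M ({a<..v} \<inter> Y) - measure N ({a<..v} \<inter> Y))
     + (measure N ({a<..v} - Y) - measure M ({a<..v} - Y))" for v
  have "TV g a b \<le> ereal (W b)"
    unfolding TV_eq_incr_var
  proof (rule incr_var_le_superadd)
    fix u v assume uv: "a \<le> u" "u \<le> v" "v \<le> b"
    have sums: "measure K ({a<..v} \<inter> Z) = measure K ({a<..u} \<inter> Z) + measure K ({u<..v} \<inter> Z)"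
      if "finite_measure K" "sets K = sets L" "Z \<in> sets L" for K Z
    proof -
      have "{a<..v} \<inter> Z = ({a<..u} \<inter> Z) \<union> ({u<..v} \<inter> Z)" using uv by auto
      then show ?thesis
        using that Ioc[of a u] Ioc[of u v] uv sets
        by (subst finite_measure.finite_measure_Union[symmetric]) auto
    qed
    have diff: "measure K ({a<..v} - Y) = measure K ({a<..u} - Y) + measure K ({u<..v} - Y)"
      if "finite_measure K" "sets K = sets L" for K
    proof -
      have "{a<..v} - Y = {a<..v} \<inter> ({a<..b} - Y)" "{a<..u} - Y = {a<..u} \<inter> ({a<..b} - Y)"
        "{u<..v} - Y = {u<..v} \<inter> ({a<..b} - Y)"
        using uv by auto
      moreover have "{a<..b} - Y \<in> sets L" using Ioc[of a b] Y sets by auto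
      ultimately show ?thesis using sums[OF that] by simp
    qed
    have "W v = W u + (measure M ({u<..v} \<inter> Y) - measure N ({u<..v} \<inter> Y))
        + (measure N ({u<..v} - Y) - measure M ({u<..v} - Y))"
      using sums[of M Y] sums[of N Y] diff[of M] diff[of N] fin sets Y by (simp add: W_def)
    moreover have "measure N ({u<..v} \<inter> Y) \<le> measure M ({u<..v} \<inter> Y)"
      using Y Ioc uv by (intro Y1') auto
    moreover have "measure M ({u<..v} - Y) \<le> measure N ({u<..v} - Y)"
      using Y Ioc uv by (intro Y2') auto
    ultimately show "W u + \<bar>g v - g u\<bar> \<le> W v"
      using g[OF uv] split[OF Ioc, of u v] uv by simp
  qed (auto simp: W_def)
  with TV have "measure M {a<..b} + measure N {a<..b} \<le> W b" by (metis ereal_less_eq(3) order_trans)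
  \<comment> \<open>The sum of the total masses minus \<open>W b\<close> is twice the left-hand
    side.\<close>
  then have "measure N ({a<..b} \<inter> Y) + measure M ({a<..b} - Y) \<le> 0"
    using split[OF Ioc, of a b] by (simp add: W_def)
  then have 0: "measure N ({a<..b} \<inter> Y) = 0" "measure M ({a<..b} - Y) = 0"
    using measure_nonneg[of N "{a<..b} \<inter> Y"] measure_nonneg[of M "{a<..b} - Y"] by linarith+
  have sub: "A \<subseteq> {a<..b}" if "A \<in> sets L" for A
    using sets.sets_into_space[OF that] by (simp add: L_def)
  have N0: "measure N X = 0" if "X \<in> sets L" "X \<subseteq> Y" for X
    using N.finite_measure_mono[of X "{a<..b} \<inter> Y"] 0 sub[OF that(1)] that Y Ioc[of a b] sets
      measure_nonneg[of N X] by auto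
  have M0: "measure M X = 0" if "X \<in> sets L" "X \<inter> Y = {}" for X
  proof -
    have "X \<subseteq> {a<..b} - Y" using sub[OF that(1)] that by auto
    then show ?thesis
      using M.finite_measure_mono[of X "{a<..b} - Y"] 0 Y Ioc[of a b] sets measure_nonneg[of M X] by auto
  qed
  have "hahn_set L (\<lambda>A. measure M A - measure N A) Y"
    unfolding hahn_set_def
  proof (intro conjI ballI impI)
    fix A assume A: "A \<in> sets L"
    show "0 \<le> measure M A - measure N A" if "A \<subseteq> Y" using N0[OF A that] by simp
    show "measure M A - measure N A \<le> 0" if "A \<subseteq> space L - Y"
    proof -
      have "A \<inter> Y = {}" using that by blast
      then show ?thesis using M0[OF A] by simp
    qed
  qed (use Y sets in simp)
  moreover have "measure M A = measure M (A \<inter> Y) - measure N (A \<inter> Y)"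
    "measure N A = - (measure M (A - Y) - measure N (A - Y))" if "A \<in> sets L" for A
    using split[of A] N0[of "A \<inter> Y"] M0[of "A - Y"] that sets Y by auto
  ultimately show ?thesis unfolding hahn_jordan_def using fin sets by blast
qed

section \<open>The signed measure of \<open>g\<close> and its Hahn-Jordan decomposition\<close>

context cadlag_function
begin

text \<open>The two parts are the Stieltjes measures of \<open>U.var\<close> and
  \<open>D.var\<close>. Their total masses add up to \<open>TV g a b\<close>, which is the criterion
  for mutual singularity in \<open>hahn_jordan_of_TV\<close>.\<close>

lemma ex_hahn_jordan:
  "\<exists>\<mu>. finite_signed_measure (restrict_space borel {a<..b}) \<mu>
      \<and> (\<forall>a1 b1. a \<le> a1 \<and> a1 \<le> b1 \<and> b1 \<le> b \<longrightarrow> \<mu> {a1<..b1} = g b1 - g a1)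
      \<and> (\<forall>\<nu>. finite_signed_measure (restrict_space borel {a<..b}) \<nu>
            \<and> (\<forall>a1 b1. a \<le> a1 \<and> a1 \<le> b1 \<and> b1 \<le> b \<longrightarrow> \<nu> {a1<..b1} = g b1 - g a1)
            \<longrightarrow> (\<forall>A\<in>sets (restrict_space borel {a<..b}). \<nu> A = \<mu> A))
      \<and> (\<exists>\<mu>p \<mu>n. hahn_jordan (restrict_space borel {a<..b}) \<mu> \<mu>p \<mu>n
            \<and> (\<forall>a1 b1. a \<le> a1 \<and> a1 \<le> b1 \<and> b1 \<le> b \<longrightarrow>
                  ereal (measure \<mu>p {a1<..b1}) = UTVc c f a b1 - UTVc c f a a1
                  \<and> ereal (measure \<mu>n {a1<..b1}) = DTVc c f a b1 - DTVc c f a a1))"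
proof -
  define M where "M = restrict_space (interval_measure U.var) {a<..b}"
  define N where "N = restrict_space (interval_measure D.var) {a<..b}"
  define \<mu> where "\<mu> A = measure M A - measure N A" for A
  have le: "a \<le> b" using ab by simp
  have mono_U: "mono U.var" and mono_D: "mono D.var"
    by (auto intro!: monoI U.var_mono D.var_mono)
  note M = restrict_interval_measure[OF mono_U U.var_right_cont le, folded M_def]
  note N = restrict_interval_measure[OF mono_D D.var_right_cont le, folded N_def]
  have \<mu>: "finite_signed_measure (restrict_space borel {a<..b}) \<mu>"
    unfolding \<mu>_def using M N by (intro finite_signed_measure_diff)
  have \<mu>_Ioc: "\<mu> {u<..v} = g v - g u" if "a \<le> u" "u \<le> v" "v \<le> b" for u v
    using M(3)[OF that] N(3)[OF that] by (simp add: \<mu>_def g_def)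
  have hahn: "hahn_jordan (restrict_space borel {a<..b}) \<mu> M N"
    unfolding \<mu>_def
  proof (rule hahn_jordan_of_TV[OF le M(2) N(2) M(1) N(1)])
    show "g v - g u = measure M {u<..v} - measure N {u<..v}" if "a \<le> u" "u \<le> v" "v \<le> b" for u v
      using \<mu>_Ioc[OF that] by (simp add: \<mu>_def)
    show "ereal (measure M {a<..b} + measure N {a<..b}) \<le> TV g a b"
      using TVc_eq_TV_g_and_add[OF le order.refl] M(3)[OF order.refl le order.refl] N(3)[OF order.refl le order.refl]
      by (simp add: UTVc_eq DTVc_eq le U.var_left_end D.var_left_end)
  qed
  have unique: "\<nu> A = \<mu> A"
    if "finite_signed_measure (restrict_space borel {a<..b}) \<nu>"
      "\<forall>a1 b1. a \<le> a1 \<and> a1 \<le> b1 \<and> b1 \<le> b \<longrightarrow> \<nu> {a1<..b1} = g b1 - g a1"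
      "A \<in> sets (restrict_space borel {a<..b})" for \<nu> A
  proof (rule finite_signed_measure_eqI[OF le that(1) \<mu> _ that(3)])
    fix u v assume uv: "a \<le> u" "u \<le> v" "v \<le> b"
    then have "\<nu> {u<..v} = g v - g u" using that(2) by blast
    then show "\<nu> {u<..v} = \<mu> {u<..v}" using \<mu>_Ioc[OF uv] by simp
  qed
  have hj: "\<exists>\<mu>p \<mu>n. hahn_jordan (restrict_space borel {a<..b}) \<mu> \<mu>p \<mu>n
      \<and> (\<forall>a1 b1. a \<le> a1 \<and> a1 \<le> b1 \<and> b1 \<le> b \<longrightarrow>
            ereal (measure \<mu>p {a1<..b1}) = UTVc c f a b1 - UTVc c f a a1
            \<and> ereal (measure \<mu>n {a1<..b1}) = DTVc c f a b1 - DTVc c f a a1)"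
  proof (intro exI conjI allI impI)
    show "hahn_jordan (restrict_space borel {a<..b}) \<mu> M N" by (fact hahn)
    fix u v assume uv: "a \<le> u \<and> u \<le> v \<and> v \<le> b"
    then show "ereal (measure M {u<..v}) = UTVc c f a v - UTVc c f a u"
      "ereal (measure N {u<..v}) = DTVc c f a v - DTVc c f a u"
      using M(3)[of u v] N(3)[of u v] by (simp_all add: UTVc_eq DTVc_eq)
  qed
  show ?thesis
  proof (rule exI[of _ \<mu>], intro conjI)
    show "\<forall>a1 b1. a \<le> a1 \<and> a1 \<le> b1 \<and> b1 \<le> b \<longrightarrow> \<mu> {a1<..b1} = g b1 - g a1"
      using \<mu>_Ioc by blast
    show "\<forall>\<nu>. finite_signed_measure (restrict_space borel {a<..b}) \<nu>
        \<and> (\<forall>a1 b1. a \<le> a1 \<and> a1 \<le> b1 \<and> b1 \<le> b \<longrightarrow> \<nu> {a1<..b1} = g b1 - g a1)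
        \<longrightarrow> (\<forall>A\<in>sets (restrict_space borel {a<..b}). \<nu> A = \<mu> A)"
      by (intro allI impI ballI, elim conjE) (rule unique)
  qed (fact \<mu> hj)+
qed

section \<open>The infimum and its minimizers\<close>

lemma osc_norm_le_iff: "osc_norm a b h \<le> ereal r \<longleftrightarrow> (\<forall>s\<in>{a..b}. \<forall>u\<in>{a..b}. \<bar>h s - h u\<bar> \<le> r)"
  by (simp add: osc_norm_def SUP_le_iff)

lemma TVc_le_TV_add:
  assumes "osc_norm a b h \<le> ereal c"
  shows "TVc c f a b \<le> TV (\<lambda>t. f t + h t) a b"
proof (rule TVc_le_TV)
  fix u v assume "u \<in> {a..b}" "v \<in> {a..b}"
  then have "\<bar>h v - h u\<bar> \<le> c" using assms unfolding osc_norm_le_iff by blast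
  then show "\<bar>f v + h v - f v - (f u + h u - f u)\<bar> \<le> c" by simp
qed

text \<open>The lower bound \<open>TVc_le_TV_add\<close> holds for every competitor, so one
  competitor attaining it settles the infimum.\<close>

lemma INF_TV_eq:
  assumes h: "osc_norm a b h \<le> ereal c" "TV (\<lambda>t. f t + h t) a b = TVc c f a b"
  shows "(INF h\<in>{h. osc_norm a b h \<le> ereal c}. TV (\<lambda>t. f t + h t) a b) = TVc c f a b"
  using h TVc_le_TV_add by (intro antisym INF_lower2[of h] INF_greatest) auto

text \<open>An interval of length \<open>c\<close> that contains all values of \<open>g - f\<close> is translated to
  \<open>[- c / 2, c / 2]\<close>.\<close>

lemma ex_translate_sup_norm_le:
  obtains r where "sup_norm a b (\<lambda>t. g t + r - f t) \<le> ereal (c / 2)"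
proof -
  \<comment> \<open>\<open>m\<close> is the least upper bound of \<open>g - f\<close>; the shift by
    \<open>c / 2 - m\<close> moves it to \<open>c / 2\<close>.\<close>
  define m where "m = (SUP t\<in>{a..b}. g t - f t)"
  have osc: "g t - f t \<le> g s - f s + c" if "s \<in> {a..b}" "t \<in> {a..b}" for s t
    using osc_g[OF that] by linarith
  have bdd: "bdd_above ((\<lambda>t. g t - f t) ` {a..b})"
    using osc[of a] ab by (intro bdd_aboveI[of _ "g a - f a + c"]) auto
  have "\<bar>g t + (c / 2 - m) - f t\<bar> \<le> c / 2" if "t \<in> {a..b}" for t
  proof -
    have "g t - f t \<le> m" unfolding m_def using that bdd by (intro cSUP_upper)
    moreover have "m \<le> g t - f t + c" unfolding m_def using that osc by (intro cSUP_least) auto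
    ultimately show ?thesis by linarith
  qed
  then show thesis by (intro that[of "c / 2 - m"]) (simp add: sup_norm_def SUP_le_iff)
qed

end

theorem mainTheorem2:
  fixes a b c :: real and f :: "real \<Rightarrow> real"
  assumes "a < b"
    and "cadlag_on a b f"
    and "0 < c"
  shows "(INF h\<in>{h. osc_norm a b h \<le> ereal c}. TV (\<lambda>t. f t + h t) a b) = TVc c f a b
    \<and> (\<exists>hc fc. hc = (\<lambda>t. fc t - f t)
        \<and> cadlag_on a b fc
        \<and> osc_norm a b hc \<le> ereal c
        \<and> TV (\<lambda>t. f t + hc t) a b
            = (INF h\<in>{h. osc_norm a b h \<le> ereal c}. TV (\<lambda>t. f t + h t) a b)
        \<and> sup_norm a b (\<lambda>t. fc t - f t) \<le> ereal (c / 2)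
        \<and> TV fc a b = TVc c f a b)
    \<and> (\<exists>h0 f0. f0 = (\<lambda>t. f t + h0 t - f a)
        \<and> osc_norm a b h0 \<le> ereal c
        \<and> h0 a = 0
        \<and> TV (\<lambda>t. f t + h0 t) a b
            = (INF h\<in>{h. osc_norm a b h \<le> ereal c}. TV (\<lambda>t. f t + h t) a b)
        \<and> cadlag_on a b f0
        \<and> (\<forall>t\<in>{a..b}. \<not> continuous (at t within {a..b}) f0 \<longrightarrow> \<not> continuous (at t within {a..b}) f)
        \<and> (\<forall>s\<in>{a<..b}. ereal (f0 s) = UTVc c f a s - DTVc c f a s
              \<and> TV f0 a s = TVc c f a s
              \<and> TVc c f a s = UTVc c f a s + DTVc c f a s)
        \<and> (\<exists>\<mu>. finite_signed_measure (restrict_space borel {a<..b}) \<mu>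
              \<and> (\<forall>a1 b1. a \<le> a1 \<and> a1 \<le> b1 \<and> b1 \<le> b \<longrightarrow> \<mu> {a1<..b1} = f0 b1 - f0 a1)
              \<and> (\<forall>\<nu>. finite_signed_measure (restrict_space borel {a<..b}) \<nu>
                    \<and> (\<forall>a1 b1. a \<le> a1 \<and> a1 \<le> b1 \<and> b1 \<le> b \<longrightarrow> \<nu> {a1<..b1} = f0 b1 - f0 a1)
                    \<longrightarrow> (\<forall>A\<in>sets (restrict_space borel {a<..b}). \<nu> A = \<mu> A))
              \<and> (\<exists>\<mu>p \<mu>n. hahn_jordan (restrict_space borel {a<..b}) \<mu> \<mu>p \<mu>n
                    \<and> (\<forall>a1 b1. a \<le> a1 \<and> a1 \<le> b1 \<and> b1 \<le> b \<longrightarrow>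
                          ereal (measure \<mu>p {a1<..b1}) = UTVc c f a b1 - UTVc c f a a1
                          \<and> ereal (measure \<mu>n {a1<..b1}) = DTVc c f a b1 - DTVc c f a a1))))"
proof -
  interpret cadlag_function a b c f using assms by unfold_locales
  define INFTV where "INFTV = (INF h\<in>{h. osc_norm a b h \<le> ereal c}. TV (\<lambda>t. f t + h t) a b)"
  have le: "a \<le> b" using ab by simp
  have TV_g: "TV g a b = TVc c f a b" using TVc_eq_TV_g_and_add le by blast
  \<comment> \<open>Adding a constant changes neither oscillation nor total variation, so one
    statement for all \<open>r\<close> serves both minimizers; \<open>h0\<close> is the case
    \<open>r = f a\<close>.\<close>
  have osc: "osc_norm a b (\<lambda>t. g t + r - f t) \<le> ereal c" for r
    unfolding osc_norm_le_iff
  proof (intro ballI)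
    fix s t assume "s \<in> {a..b}" "t \<in> {a..b}"
    then show "\<bar>g s + r - f s - (g t + r - f t)\<bar> \<le> c" using osc_g[of t s] by simp
  qed
  have TV_h: "TV (\<lambda>t. f t + (g t + r - f t)) a b = TVc c f a b" for r
    using TV_g by (simp add: TV_translate)
  have INF: "INFTV = TVc c f a b"
    unfolding INFTV_def using osc TV_h by (rule INF_TV_eq)
  obtain r where r: "sup_norm a b (\<lambda>t. g t + r - f t) \<le> ereal (c / 2)"
    using ex_translate_sup_norm_le .
  have cadlag_r: "cadlag_on a b (\<lambda>t. g t + r)"
    unfolding cadlag_on_def
  proof (intro conjI ballI)
    show "((\<lambda>t. g t + r) \<longlongrightarrow> g t + r) (at_right t)" if "t \<in> {a..<b}" for t
      using cadlag_g that by (intro tendsto_intros) (simp add: cadlag_on_def)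
    fix t assume "t \<in> {a<..b}"
    then obtain l where "(g \<longlongrightarrow> l) (at_left t)" using cadlag_g unfolding cadlag_on_def by blast
    then have "((\<lambda>t. g t + r) \<longlongrightarrow> l + r) (at_left t)" by (intro tendsto_intros)
    then show "\<exists>l. ((\<lambda>t. g t + r) \<longlongrightarrow> l) (at_left t)" by blast
  qed
  have 2: "\<exists>hc fc. hc = (\<lambda>t. fc t - f t) \<and> cadlag_on a b fc \<and> osc_norm a b hc \<le> ereal c
        \<and> TV (\<lambda>t. f t + hc t) a b = INFTV
        \<and> sup_norm a b (\<lambda>t. fc t - f t) \<le> ereal (c / 2) \<and> TV fc a b = TVc c f a b"
    by (rule exI[of _ "\<lambda>t. g t + r - f t"], rule exI[of _ "\<lambda>t. g t + r"])
      (use cadlag_r osc[of r] TV_h[of r] INF r TV_g in \<open>simp only: TV_translate\<close>)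
  \<comment> \<open>The constant \<open>f a\<close> in \<open>h0\<close> gives
    \<open>h0 a = 0\<close>, as \<open>g\<close> vanishes at \<open>a\<close>, and it cancels in
    \<open>f0\<close>.\<close>
  have g: "g = (\<lambda>t. f t + (g t + f a - f t) - f a)" by simp
  have UD: "ereal (g s) = UTVc c f a s - DTVc c f a s \<and> TV g a s = TVc c f a s
      \<and> TVc c f a s = UTVc c f a s + DTVc c f a s" if "s \<in> {a<..b}" for s
    using TVc_eq_TV_g_and_add[of s] that by (simp add: UTVc_eq DTVc_eq g_def)
  show ?thesis
    unfolding INFTV_def[symmetric]
  proof (intro conjI INF 2, rule exI[of _ "\<lambda>t. g t + f a - f t"], rule exI[of _ g],
      intro conjI g osc cadlag_g ex_hahn_jordan)
    show "g a + f a - f a = 0" using g_left_end by simp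
    show "TV (\<lambda>t. f t + (g t + f a - f t)) a b = INFTV" using TV_h INF by simp
    show "\<forall>t\<in>{a..b}. \<not> continuous (at t within {a..b}) g \<longrightarrow> \<not> continuous (at t within {a..b}) f"
      using continuous_g by blast
    show "\<forall>s\<in>{a<..b}. ereal (g s) = UTVc c f a s - DTVc c f a s \<and> TV g a s = TVc c f a s
        \<and> TVc c f a s = UTVc c f a s + DTVc c f a s"
      using UD by blast
  qed
qed

end
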